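(* For every integer $n \geq 9$, the inequality $p_{n+2}^3 < p_{n+1}^3 + p_n^3$ holds, where $p_n$ denotes the $n$th prime number.
   Context: The primes are indexed in increasing order starting from $n=1$: $p_1 = 2$, $p_2 = 3$, $p_3 = 5$, and so on (so $p_9 = 23$). *)

theory Defs
  imports "HOL-Library.Infinite_Set" "HOL-Computational_Algebra.Primes"
begin

(* Primes are indexed from 1, whereas enumerate starts at 0.
   The value at 0 is a dummy (it coincides with the value at 1). *)
definition nth_prime :: "nat \<Rightarrow> nat" where
  "nth_prime n = enumerate {p. prime p} (n - 1)"

end

theory Submission
  imports Defs "HOL-Number_Theory.Prime_Powers" Complex_Main
begin

text \<open>
  Since $1.25^3 < 2$, it suffices to find two primes in $(p, 5p/4]$ for $p = p_n$. Chebyshev's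
  combination $\ln \lfloor x \rfloor! - \ln \lfloor x/2 \rfloor! - \ln \lfloor x/3 \rfloor!
  - \ln \lfloor x/5 \rfloor! + \ln \lfloor x/30 \rfloor!$ is $A x + O(\ln x)$ and lies between
  $\psi(x) - \psi(x/6)$ and $\psi(x)$. Hence $\psi(x) \ge A x - O(\ln x)$ and, iterating,
  $\psi(x) \le \frac{6}{5} A x + O(\ln^2 x)$, so that $\psi(5p/4) - \psi(p)$ is at least about
  $A p / 20$. Proper prime powers contribute only $O(\sqrt p \ln p)$ to this difference, and a
  single prime only $O(\ln p)$, which settles $p \ge 2^{17}$. Smaller $p$ are covered by an
  explicit list of pairs of primes.
\<close>

section \<open>Chebyshev's bounds\<close>

definition psi :: "nat \<Rightarrow> real" where
  "psi n = (\<Sum>d=1..n. mangoldt d)"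

text \<open>The constant $A$ of the overview, numerically about 0.9213.\<close>

definition chebyshev_const :: real where
  "chebyshev_const = ln 2 / 2 + ln 3 / 3 + ln 5 / 5 - ln 30 / 30"

definition chebyshev_sum :: "nat \<Rightarrow> real" where
  "chebyshev_sum n = ln (fact n) - ln (fact (n div 2)) - ln (fact (n div 3))
     - ln (fact (n div 5)) + ln (fact (n div 30))"

text \<open>Legendre's formula: \<open>ln k\<close> sums \<open>mangoldt\<close> over the divisors
  of \<open>k\<close>, and \<open>n div d\<close> counts the multiples of \<open>d\<close> up to
  \<open>n\<close>. A bound \<open>N\<close> beyond \<open>n\<close> only adds zero terms, so that
  all five factorials in \<open>chebyshev_sum\<close> can share one range of summation.\<close>

lemma ln_fact_eq_sum_mangoldt:
  assumes "n \<le> N"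
  shows "ln (fact n) = (\<Sum>d=1..N. mangoldt d * real (n div d))"
  using assms
proof (induction n)
  case 0
  then show ?case by simp
next
  case (Suc n)
  have eq: "real (Suc n div d) = real (n div d) + (if d dvd Suc n then 1 else 0)" for d
    by (auto simp: div_Suc mod_eq_0_iff_dvd)
  have "(\<Sum>d=1..N. if d dvd Suc n then mangoldt d else 0) = (\<Sum>d | d dvd Suc n. mangoldt d :: real)"
    using Suc.prems by (subst sum.inter_filter [symmetric])
      (auto intro!: sum.cong Nat.gr0I dest: dvd_imp_le simp: Suc_le_eq)
  also have "\<dots> = ln (real (Suc n))"
    by (subst mangoldt_sum) auto
  finally have *: "(\<Sum>d=1..N. if d dvd Suc n then mangoldt d else 0) = ln (real (Suc n))" .
  have "ln (fact (Suc n)) = ln (real (Suc n)) + ln (fact n)"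
    by (simp add: ln_mult del: of_nat_Suc)
  also have "\<dots> = (\<Sum>d=1..N. mangoldt d * real (Suc n div d))"
    using Suc * unfolding eq
    by (simp add: distrib_left sum.distrib if_distrib [of "\<lambda>x. _ * x"] cong: if_cong)
  finally show ?case .
qed

text \<open>Since 1 = 1/2 + 1/3 + 1/5 - 1/30, the expression depends only on \<open>k\<close> modulo
  30, which leaves 30 residues to check.\<close>

lemma chebyshev_weight:
  fixes k :: nat
  defines "g \<equiv> int k - int (k div 2) - int (k div 3) - int (k div 5) + int (k div 30)"
  shows "0 \<le> g" "g \<le> 1" "k \<in> {1..5} \<Longrightarrow> g = 1"
proof -
  obtain a r where k: "k = 30 * a + r" "r < 30"
    by (metis mod_less_divisor mult_div_mod_eq zero_less_numeral)
  have "k div 2 = 15 * a + r div 2" "k div 3 = 10 * a + r div 3"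
    "k div 5 = 6 * a + r div 5" "k div 30 = a"
    using k by auto
  then have g: "g = int r - int (r div 2) - int (r div 3) - int (r div 5)"
    by (simp add: g_def k)
  have "r \<in> {..<30}" using k by simp
  also have "{..<30} = set [0..<30]" by auto
  finally have "0 \<le> g \<and> g \<le> 1"
    unfolding g by (auto simp: upt_rec)
  then show "0 \<le> g" "g \<le> 1" by auto
  show "g = 1" if "k \<in> {1..5}"
  proof -
    have "k \<in> {1,2,3,4,5}" using that by auto
    then show ?thesis unfolding g_def by auto
  qed
qed

lemma psi_eq_add_sum:
  assumes "m \<le> n"
  shows "psi n = psi m + (\<Sum>d\<in>{m<..n}. mangoldt d)"
proof -
  have "{1..n} = {1..m} \<union> {m<..n}" using assms by auto
  then show ?thesis unfolding psi_def by (simp only:, intro sum.union_disjoint) auto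
qed

text \<open>By Legendre's formula, \<open>mangoldt d\<close> enters \<open>chebyshev_sum n\<close>
  with weight \<open>g (n div d)\<close>. Weights in [0, 1] give the first bound; weight 1 for n/6 <
  d <= n, where \<open>n div d\<close> is between 1 and 5, gives the second.\<close>

lemma chebyshev_sum_bounds:
  "chebyshev_sum n \<le> psi n" "psi n \<le> psi (n div 6) + chebyshev_sum n"
proof -
  define g where "g k = int k - int (k div 2) - int (k div 3) - int (k div 5) + int (k div 30)"
    for k :: nat
  have eq: "chebyshev_sum n = (\<Sum>d=1..n. mangoldt d * real_of_int (g (n div d)))"
  proof -
    have L: "ln (fact (n div k)) = (\<Sum>d=1..n. mangoldt d * real (n div d div k))" for k
      using ln_fact_eq_sum_mangoldt [of "n div k" n]
      by (simp add: div_mult2_eq [symmetric] mult.commute)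
    show ?thesis
      unfolding chebyshev_sum_def g_def L ln_fact_eq_sum_mangoldt [OF order.refl, of n]
        sum_subtractf [symmetric] sum.distrib [symmetric]
      by (intro sum.cong) (simp_all add: algebra_simps)
  qed
  have g: "0 \<le> g k" "g k \<le> 1" "k \<in> {1..5} \<Longrightarrow> g k = 1" for k
    unfolding g_def by (rule chebyshev_weight; assumption)+
  show "chebyshev_sum n \<le> psi n"
    unfolding eq psi_def using g by (intro sum_mono mult_left_le mangoldt_nonneg) auto
  have "(\<Sum>d\<in>{n div 6<..n}. mangoldt d) =
        (\<Sum>d\<in>{n div 6<..n}. mangoldt d * real_of_int (g (n div d)))"
  proof (rule sum.cong)
    fix d assume d: "d \<in> {n div 6<..n}"
    then have "n < 6 * d" "0 < d" by (auto simp: div_less_iff_less_mult mult.commute)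
    then have "n div d < 6" "1 \<le> n div d"
      using d by (auto simp: div_less_iff_less_mult less_eq_div_iff_mult_less_eq)
    then show "mangoldt d = mangoldt d * real_of_int (g (n div d))"
      using g(3) [of "n div d"] by auto
  qed simp
  also have "\<dots> \<le> chebyshev_sum n"
    unfolding eq using g by (intro sum_mono2) (auto intro!: mult_nonneg_nonneg mangoldt_nonneg)
  finally show "psi n \<le> psi (n div 6) + chebyshev_sum n"
    using psi_eq_add_sum [of "n div 6" n] by simp
qed

section \<open>Stirling-type bounds for factorials\<close>

lemma mult_ln_minus_mono:
  fixes x y :: real
  assumes "1 \<le> x" "x \<le> y"
  shows "x * ln x - x \<le> y * ln y - y"
proof -
  have "ln (x / y) \<le> x / y - 1"
    using assms by (intro ln_le_minus_one) auto
  then have "y * (ln x - ln y) \<le> y * (x / y - 1)"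
    using assms by (intro mult_left_mono) (auto simp: ln_div)
  also have "\<dots> = x - y" using assms by (simp add: field_simps)
  finally have "y * (ln x - ln y) \<le> x - y" .
  moreover have "0 \<le> (y - x) * ln x" using assms by simp
  ultimately show ?thesis by (simp add: algebra_simps)
qed

text \<open>The induction compares increments: \<open>ln t <= t - 1\<close> yields k (ln (k+1) - ln
  k) <= 1 <= (k+1) (ln (k+1) - ln k).\<close>

lemma ln_fact_bounds:
  fixes k :: nat
  assumes "1 \<le> k"
  shows "real k * ln k - k \<le> ln (fact k)" "ln (fact k) \<le> real k * ln k - k + 1 + ln k"
  using assms
proof (induction k rule: dec_induct)
  case base
  { case 1 show ?case by simp next case 2 show ?case by simp }
next
  case (step k)
  have k: "0 < real k" using step by simp
  have fact: "ln (fact (Suc k)) = ln (real (Suc k)) + ln (fact k)"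
    by (simp add: ln_mult del: of_nat_Suc)
  have "ln (real (Suc k) / real k) \<le> real (Suc k) / real k - 1"
    using k by (intro ln_le_minus_one) auto
  then have "real k * (ln (real (Suc k)) - ln k) \<le> real k * (real (Suc k) / real k - 1)"
    using k by (intro mult_left_mono) (auto simp: ln_div)
  then have up: "real k * (ln (real (Suc k)) - ln k) \<le> 1"
    using k by (simp add: field_simps)
  have "ln (real k / real (Suc k)) \<le> real k / real (Suc k) - 1"
    using k by (intro ln_le_minus_one) auto
  then have "real (Suc k) * (ln k - ln (real (Suc k))) \<le> real (Suc k) * (real k / real (Suc k) - 1)"
    using k by (intro mult_left_mono) (auto simp: ln_div)
  then have low: "real (Suc k) * (ln k - ln (real (Suc k))) \<le> - 1"
    by (simp add: field_simps)
  { case 1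
    show ?case using step up fact by (simp add: algebra_simps)
  next
    case 2
    show ?case using step low fact by (simp add: algebra_simps) }
qed

text \<open>Here \<open>k\<close> is the floor of \<open>x\<close>. Evaluating the main term at the
  real \<open>x\<close> lets it cancel exactly in Chebyshev's combination, and \<open>n\<close>
  makes the error uniform over the five factorials.\<close>

lemma ln_fact_approx:
  fixes x :: real and k n :: nat
  assumes "0 < x" "real k \<le> x" "x < real k + 1" "k \<le> n" "1 \<le> n"
  shows "\<bar>ln (fact k) - (x * ln x - x)\<bar> \<le> 1 + ln n"
proof (cases "k = 0")
  case True
  have "ln (1 / x) \<le> 1 / x - 1" using assms by (intro ln_le_minus_one) auto
  then have "x * (- ln x) \<le> x * (1 / x - 1)"
    using assms by (intro mult_left_mono) (auto simp: ln_div)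
  moreover have "x * ln x \<le> 0"
    using assms True by (simp add: mult_le_0_iff)
  moreover have "0 \<le> ln (real n)" using assms by simp
  moreover have "ln (fact k) = (0::real)" using True by simp
  ultimately show ?thesis using assms(1) unfolding abs_le_iff right_diff_distrib
    by (auto simp: right_diff_distrib)
next
  case False
  then have k: "1 \<le> k" by simp
  have "ln (real (Suc k)) \<le> ln n + 1"
  proof -
    have "ln (real (Suc k)) \<le> ln (real (Suc n))" using assms by simp
    also have "\<dots> = ln (real n) + ln (1 + 1 / n)"
      using assms ln_mult_pos [of "real n" "1 + 1 / n"]
      by (simp add: distrib_left add.commute add_pos_pos)
    also have "ln (1 + 1 / n) \<le> 1 / n" by (rule ln_add_one_self_le_self) simp
    also have "1 / n \<le> (1::real)" using assms by simp
    finally show ?thesis by simp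
  qed
  moreover have "x * ln x - x \<le> real (Suc k) * ln (real (Suc k)) - real (Suc k)"
    using assms k by (intro mult_ln_minus_mono) auto
  moreover have "real (Suc k) * ln (real (Suc k)) - real (Suc k) \<le> ln (fact (Suc k))"
    by (rule ln_fact_bounds) simp
  moreover have "ln (fact (Suc k)) = ln (real (Suc k)) + ln (fact k)"
    by (simp add: ln_mult del: of_nat_Suc)
  moreover have "real k * ln k - k \<le> x * ln x - x"
    using assms k by (intro mult_ln_minus_mono) auto
  moreover have "ln (real k) \<le> ln n" using assms k by simp
  ultimately show ?thesis using ln_fact_bounds(2) [OF k] by linarith
qed

lemma chebyshev_sum_approx:
  assumes "1 \<le> n"
  shows "\<bar>chebyshev_sum n - chebyshev_const * n\<bar> \<le> 5 * (1 + ln n)"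
proof -
  define f :: "nat \<Rightarrow> real" where "f d = real n / d * ln (real n / d) - real n / d" for d
  define g :: "nat \<Rightarrow> real" where "g d = ln (fact (n div d))" for d
  have approx: "\<bar>g d - f d\<bar> \<le> 1 + ln n" if "d > 0" for d :: nat
    unfolding f_def g_def
  proof (rule ln_fact_approx)
    show "real (n div d) \<le> real n / d" "real n / d < real (n div d) + 1"
      using floor_divide_of_nat_eq [of n d, where 'a = real] by linarith+
  qed (use assms that in auto)
  define L where "L = 1 + ln (real n)"
  have "g d \<le> f d + L" "f d - L \<le> g d" if "d > 0" for d
    using approx [OF that] unfolding L_def by linarith+
  note this [OF zero_less_one] this [of 2, OF zero_less_numeral]
    this [of 3, OF zero_less_numeral] this [of 5, OF zero_less_numeral]
    this [of 30, OF zero_less_numeral]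
  \<comment> \<open>The terms n ln n - n cancel because 1 - 1/2 - 1/3 - 1/5 + 1/30 = 0.\<close>
  moreover have "f 1 - f 2 - f 3 - f 5 + f 30 = chebyshev_const * n"
  proof -
    have f: "f d = (real n * ln n - n) / d - n * (ln d / d)" if "0 < d" for d
      using assms that unfolding f_def by (simp add: ln_div diff_divide_distrib right_diff_distrib)
    have "chebyshev_const * n = n * (ln 2 / 2) + n * (ln 3 / 3) + n * (ln 5 / 5) - n * (ln 30 / 30)"
      unfolding chebyshev_const_def by (simp add: algebra_simps)
    then show ?thesis
      using f [of 1] f [of 2] f [of 3] f [of 5] f [of 30] by (simp add: diff_divide_distrib)
  qed
  moreover have "chebyshev_sum n = g 1 - g 2 - g 3 - g 5 + g 30"
    by (simp add: chebyshev_sum_def g_def)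
  ultimately show ?thesis unfolding L_def [symmetric] by (intro abs_leI) linarith+
qed

section \<open>Upper and lower bounds for psi\<close>

lemma psi_ge:
  assumes "1 \<le> n"
  shows "chebyshev_const * n - 5 * (1 + ln n) \<le> psi n"
  using chebyshev_sum_approx [OF assms] chebyshev_sum_bounds(1) [of n] by linarith

text \<open>Expanding \<open>ln 30\<close> gives (14 ln 2 + 9 ln 3 + 5 ln 5) / 30, and the crude
  bounds 1/2, 1, 1 for the three logarithms yield exactly 21/30.\<close>

lemma chebyshev_const_ge: "7 / 10 \<le> chebyshev_const"
proof -
  have three: "1 \<le> ln (3::real)" using exp_le by (subst ln_ge_iff) auto
  have "ln (3::real) \<le> ln 4" by simp
  also have "ln 4 = 2 * ln (2::real)" using ln_realpow [of 2 2] by simp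
  finally have two: "1 / 2 \<le> ln (2::real)" using three by simp
  have five: "ln (3::real) \<le> ln 5" by simp
  have "ln 30 = ln (2::real) + (ln 3 + ln 5)"
    using ln_mult [of 2 "15::real"] ln_mult [of 3 "5::real"] by simp
  then show ?thesis using two three five unfolding chebyshev_const_def by linarith
qed

text \<open>Iterating from \<open>n\<close> to \<open>n div 6\<close> sums the main terms to the
  geometric series 1 + 1/6 + 1/36 + ... = 6/5. As \<open>ln 6 >= 1\<close>, each step lowers the
  logarithm by at least 1, so the square absorbs the accumulated errors.\<close>

lemma psi_le:
  assumes "1 \<le> n"
  shows "psi n \<le> 6 / 5 * chebyshev_const * n + 5 * (1 + ln n)\<^sup>2"
  using assms
proof (induction n rule: less_induct)
  case (less n)
  define m where "m = n div 6"
  have step: "psi n \<le> psi m + chebyshev_const * n + 5 * (1 + ln n)"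
    using chebyshev_sum_bounds(2) [of n] chebyshev_sum_approx [OF less.prems] unfolding m_def
    by linarith
  have ln: "0 \<le> ln (real n)" using less.prems by simp
  show ?case
  proof (cases "m = 0")
    case True
    have "(1 + ln n) * 1 \<le> (1 + ln n) * (1 + ln (real n))"
      using ln by (intro mult_left_mono) auto
    moreover have "chebyshev_const * n \<le> 6 / 5 * chebyshev_const * n"
      using chebyshev_const_ge by (intro mult_right_mono) auto
    ultimately show ?thesis using step True by (simp add: psi_def power2_eq_square)
  next
    case False
    have m: "real m \<le> real n / 6" unfolding m_def by (metis of_nat_div_le_of_nat of_nat_numeral)
    have "ln (real m) \<le> ln (real n / 6)" using m False by simp
    also have "\<dots> = ln n - ln 6" using less.prems by (simp add: ln_div)
    finally have "ln (real m) \<le> ln n - ln 6" .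
    moreover have "1 \<le> ln (6::real)" using exp_le by (subst ln_ge_iff) auto
    moreover have "0 \<le> ln (real m)" using False by simp
    ultimately have "(1 + ln (real m))\<^sup>2 \<le> (ln n)\<^sup>2" "1 \<le> ln (real n)"
      by (auto intro!: power_mono)
    then have "(1 + ln (real m))\<^sup>2 + (1 + ln n) \<le> (1 + ln n)\<^sup>2"
      by (simp add: power2_eq_square algebra_simps)
    moreover have "chebyshev_const * m \<le> chebyshev_const * (n / 6)"
      using m chebyshev_const_ge by (intro mult_left_mono) auto
    moreover have "psi m \<le> 6 / 5 * chebyshev_const * m + 5 * (1 + ln m)\<^sup>2"
      using less.prems False by (intro less.IH) (auto simp: m_def)
    ultimately show ?thesis using step by (simp add: algebra_simps)
  qed
qed

section \<open>Two primes between $p$ and $5p/4$\<close>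

text \<open>As $y < 2x$, every prime has at most one power in $(x, y]$.\<close>
lemma sum_mangoldt_nonprime_le:
  fixes x y :: nat
  assumes "1 \<le> x" "x \<le> y" "y < 2 * x"
  shows "(\<Sum>d\<in>{d\<in>{x<..y}. \<not> prime d}. mangoldt d) \<le> sqrt y * ln y / 2"
proof -
  have y: "y \<noteq> 0" using assms by simp
  \<comment> \<open>Elements of \<open>D\<close> are powers q^k with k >= 2, so q <= sqrt y. Mapping
    each to its base is injective, hence \<open>D\<close> has at most sqrt y elements, each
    contributing ln q <= ln y / 2.\<close>
  define D where "D = {d\<in>{x<..y}. \<not> prime d \<and> primepow d}"
  have D: "\<exists>q k. d = q ^ k \<and> prime q \<and> aprimedivisor d = q \<and> q\<^sup>2 \<le> y"
    if d: "d \<in> D" for d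
  proof -
    obtain q k where qk: "prime q" "d = q ^ k" "0 < k"
      using d unfolding D_def primepow_def by auto
    have "k \<noteq> 1" using d qk by (auto simp: D_def)
    then have k: "2 \<le> k" using qk by simp
    have "q\<^sup>2 \<le> q ^ k" using qk k prime_gt_0_nat by (intro power_increasing) (auto simp: Suc_le_eq)
    then have "q\<^sup>2 \<le> y" using d qk by (auto simp: D_def)
    then show ?thesis using qk k by (auto simp: aprimedivisor_prime_power)
  qed
  have "inj_on aprimedivisor D"
  proof (rule inj_onI)
    fix a b assume ab: "a \<in> D" "b \<in> D" "aprimedivisor a = aprimedivisor b"
    obtain q j where j: "a = q ^ j" "prime q" "aprimedivisor a = q" using D [OF ab(1)] by blast
    obtain k where k: "b = q ^ k" using D [OF ab(2)] ab(3) j by metis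
    have *: "\<not> i < i'" if "x < q ^ i" "q ^ i' \<le> y" for i i'
    proof
      assume "i < i'"
      then have "q ^ Suc i \<le> q ^ i'" using prime_gt_0_nat [OF j(2)] by (intro power_increasing) auto
      moreover have "2 * q ^ i \<le> q ^ Suc i" using prime_ge_2_nat [OF j(2)] by simp
      ultimately show False using that assms by linarith
    qed
    show "a = b" using * [of j k] * [of k j] ab(1,2) j k by (auto simp: D_def not_less)
  qed
  moreover have "aprimedivisor ` D \<subseteq> {1..nat \<lfloor>sqrt y\<rfloor>}"
  proof
    fix q assume "q \<in> aprimedivisor ` D"
    then have q: "prime q" "q\<^sup>2 \<le> y" using D by auto
    then have "real q \<le> sqrt y" by (intro real_le_rsqrt) (metis of_nat_le_iff of_nat_power)
    then show "q \<in> {1..nat \<lfloor>sqrt y\<rfloor>}" using prime_ge_1_nat [OF q(1)] by (auto simp: le_nat_floor)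
  qed
  ultimately have "card D \<le> nat \<lfloor>sqrt y\<rfloor>"
    by (metis card_atLeastAtMost card_inj_on_le diff_Suc_1 finite_atLeastAtMost)
  then have "real (card D) \<le> sqrt y"
    by (metis of_nat_floor of_nat_0_le_iff of_nat_le_iff order_trans real_sqrt_ge_zero)
  moreover have "0 \<le> ln (real y)" using y by simp
  ultimately have card: "real (card D) * (ln y / 2) \<le> sqrt y * (ln y / 2)" by (intro mult_right_mono) auto
  have "(\<Sum>d\<in>{d\<in>{x<..y}. \<not> prime d}. mangoldt d) = (\<Sum>d\<in>D. mangoldt d :: real)"
    by (rule sum.mono_neutral_right) (auto simp: D_def mangoldt_def)
  also have "\<dots> \<le> real (card D) * (ln y / 2)"
  proof (rule sum_bounded_above)
    fix d assume d: "d \<in> D"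
    obtain q where q: "aprimedivisor d = q" "prime q" "q\<^sup>2 \<le> y" using D [OF d] by blast
    have "2 * ln (real q) = ln (real (q\<^sup>2))" using prime_gt_0_nat [OF q(2)] by (simp add: ln_realpow)
    also have "\<dots> \<le> ln y" using q prime_gt_0_nat [OF q(2)] y
      by (subst ln_le_cancel_iff) (auto simp del: of_nat_power)
    finally show "mangoldt d \<le> ln y / 2" using d q by (simp add: mangoldt_def D_def)
  qed
  finally show ?thesis using card by simp
qed

text \<open>Read backwards, this bounds the number of primes in the interval from below by the
  growth of \<open>psi\<close>.\<close>

lemma psi_diff_le:
  fixes x y :: nat
  assumes "1 \<le> x" "x \<le> y" "y < 2 * x"
  shows "psi y - psi x \<le> real (card {q\<in>{x<..y}. prime q}) * ln y + sqrt y * ln y / 2"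
proof -
  have "(\<Sum>d\<in>{q\<in>{x<..y}. prime q}. mangoldt d) \<le> real (card {q\<in>{x<..y}. prime q}) * ln y"
  proof (rule sum_bounded_above)
    fix d assume "d \<in> {q\<in>{x<..y}. prime q}"
    then show "mangoldt d \<le> ln (real y)" using assms by (auto simp: prime_gt_0_nat)
  qed
  moreover have "(\<Sum>d\<in>{x<..y}. mangoldt d :: real) = (\<Sum>d\<in>{q\<in>{x<..y}. prime q}. mangoldt d) +
      (\<Sum>d\<in>{d\<in>{x<..y}. \<not> prime d}. mangoldt d)"
  proof -
    have "{x<..y} = {q\<in>{x<..y}. prime q} \<union> {d\<in>{x<..y}. \<not> prime d}" by blast
    then show ?thesis
      by (metis (no_types, lifting) sum.union_disjoint finite_Un finite_greaterThanAtMost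
        disjoint_iff mem_Collect_eq)
  qed
  ultimately show ?thesis
    using sum_mangoldt_nonprime_le [OF assms] psi_eq_add_sum [OF assms(2)] by linarith
qed

section \<open>Numerical comparison of main term and errors\<close>

lemma ln_2_le: "ln 2 \<le> (7 / 10 :: real)"
proof -
  \<comment> \<open>221/200 = 1 + 1/10 + 1/200 is the quadratic Taylor polynomial at 1/10; its
    seventh power just exceeds 2.\<close>
  have "221 / 200 \<le> exp (1 / 10 :: real)"
    using exp_lower_Taylor_quadratic [of "1 / 10"] by (simp add: power2_eq_square)
  then have "(221 / 200) ^ 7 \<le> exp (1 / 10 :: real) ^ 7" by (intro power_mono) auto
  also have "\<dots> = exp (7 / 10)" by (simp flip: exp_of_nat_mult)
  finally have "(221 / 200) ^ 7 \<le> exp (7 / 10 :: real)" .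
  moreover have "2 \<le> (221 / 200 :: real) ^ 7" by (simp add: power_divide)
  ultimately have "2 \<le> exp (7 / 10 :: real)" by (rule order_trans [rotated])
  then have "ln 2 \<le> ln (exp (7 / 10 :: real))" by (subst ln_le_cancel_iff) auto
  then show ?thesis by simp
qed

text \<open>In terms of t = y^(1/4) - 19, nonnegative because 19^4 = 130321 < 2^17, a linear bound
  on \<open>ln y\<close> turns the claim into a polynomial inequality. The difference of its two
  sides is a quartic in \<open>t\<close> with positive coefficients.\<close>

lemma psi_gap_estimate:
  fixes y :: nat
  assumes "2 ^ 17 \<le> y"
  shows "5 * (1 + ln y) + 5 * (1 + ln y)\<^sup>2 + ln y + sqrt y * ln y / 2
         < 7 / 10 * (y / 25 - 24 / 25)"
proof -
  define z where "z = sqrt (sqrt y)"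
  define t where "t = z - 19"
  have z2: "z\<^sup>2 = sqrt y" unfolding z_def by simp
  have "z ^ 4 = (z\<^sup>2)\<^sup>2" by simp
  then have z4: "z ^ 4 = y" unfolding z2 by simp
  have "19 ^ 4 \<le> real y" using assms by simp
  then have "19\<^sup>2 \<le> sqrt y" by (intro real_le_rsqrt) simp
  then have "19 \<le> z" unfolding z_def by (intro real_le_rsqrt [of 19]) simp
  then have t: "0 \<le> t" by (simp add: t_def)
  \<comment> \<open>Tangent to \<open>ln\<close> at 16: close to 19, and a power of 2, so only
    \<open>ln 2\<close> needs a numerical bound.\<close>
  have "ln (z / 16) \<le> z / 16 - 1" using t by (intro ln_le_minus_one) (auto simp: t_def)
  moreover have "ln (z / 16) = ln z - 4 * ln 2"
    using t ln_realpow [of "2::real" 4] by (simp add: ln_div t_def)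
  ultimately have "ln z \<le> z / 16 + 9 / 5" using ln_2_le by linarith
  then have "4 * ln z \<le> 12 + t / 4" by (simp add: t_def field_simps)
  moreover have "ln (real y) = 4 * ln z"
    using t ln_realpow [of z 4] by (simp add: t_def flip: z4)
  ultimately have l: "ln (real y) \<le> 12 + t / 4" by simp
  have l0: "0 \<le> ln (real y)" using assms by simp
  have lin: "5 * (1 + ln y) \<le> 5 * (13 + t / 4)" using l by simp
  have sq: "(1 + ln (real y))\<^sup>2 \<le> (13 + t / 4)\<^sup>2"
    using l l0 by (intro power_mono) auto
  have root: "sqrt y * ln y \<le> (19 + t)\<^sup>2 * (12 + t / 4)"
    using l l0 t unfolding z2 [symmetric] by (intro mult_mono) (auto simp: t_def)
  have "5 * (1 + ln y) + 5 * (1 + ln y)\<^sup>2 + ln y + sqrt y * ln y / 2 \<le>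
      5 * (13 + t / 4) + 5 * (13 + t / 4)\<^sup>2 + (12 + t / 4) + (19 + t)\<^sup>2 * (12 + t / 4) / 2"
    by (intro lin sq root l add_mono mult_left_mono divide_right_mono) simp_all
  also have "\<dots> < 7 / 10 * ((19 + t) ^ 4 / 25 - 24 / 25)"
    using t
    by (simp add: power4_eq_xxxx power3_eq_cube power2_eq_square field_simps)
      (rule add_nonneg_pos, simp, rule add_nonneg_pos, simp, rule add_pos_nonneg, simp_all)
  also have "(19 + t) ^ 4 = y" by (simp add: t_def z4)
  finally show ?thesis .
qed

text \<open>With at most one prime, psi y - psi p is at most ln y + sqrt y ln y / 2. But p <= 4 (y +
  1) / 5, rounding included, so the main terms A y - (6/5) A p are at least A (y/25 - 24/25),
  contradicting \<open>psi_gap_estimate\<close>.\<close>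

lemma card_primes_ge_2:
  fixes p :: nat
  assumes "2 ^ 17 \<le> p"
  shows "2 \<le> card {q \<in> {p<..5 * p div 4}. prime q}"
proof (rule ccontr)
  define y where "y = 5 * p div 4"
  assume "\<not> ?thesis"
  then have "real (card {q \<in> {p<..y}. prime q}) * ln y \<le> 1 * ln y"
    using assms by (intro mult_right_mono) (auto simp: y_def)
  moreover have py: "p \<le> y" "y < 2 * p" "1 \<le> p" "5 * p \<le> 4 * y + 4"
    using assms by (auto simp: y_def)
  ultimately have diff: "psi y - psi p \<le> ln y + sqrt y * ln y / 2"
    using psi_diff_le [of p y] by simp
  have "psi p \<le> 6 / 5 * chebyshev_const * p + 5 * (1 + ln p)\<^sup>2"
    using py by (intro psi_le)
  moreover have "(1 + ln (real p))\<^sup>2 \<le> (1 + ln (real y))\<^sup>2"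
    using py(1,3) by (intro power_mono add_left_mono) simp_all
  moreover have "chebyshev_const * y - 5 * (1 + ln y) \<le> psi y"
    using py by (intro psi_ge) linarith
  moreover have "chebyshev_const * (6 / 5 * p) \<le> chebyshev_const * (24 / 25 * (y + 1))"
    using py chebyshev_const_ge by (intro mult_left_mono) auto
  moreover have "7 / 10 * (real y / 25 - 24 / 25) \<le> chebyshev_const * (real y / 25 - 24 / 25)"
    using chebyshev_const_ge assms py by (intro mult_right_mono) auto
  moreover have "5 * (1 + ln y) + 5 * (1 + ln y)\<^sup>2 + ln y + sqrt y * ln y / 2
         < 7 / 10 * (real y / 25 - 24 / 25)"
    using assms py by (intro psi_gap_estimate) linarith
  ultimately show False using diff by (simp add: algebra_simps)
qed

section \<open>Explicit primes\<close>

definition no_divisor :: "nat \<Rightarrow> nat \<Rightarrow> nat \<Rightarrow> bool" where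
  "no_divisor n d s \<longleftrightarrow> (\<forall>i. d + 2 * i < s \<longrightarrow> \<not> (d + 2 * i) dvd n)"

text \<open>
  Conditionals instead of connectives: the simplifier evaluates them lazily, so that rewriting
  with this recursion terminates.
\<close>
lemma no_divisor_step:
  "no_divisor n d s \<longleftrightarrow>
    (if s \<le> d then True else if n mod d = 0 then False else no_divisor n (d + 2) s)"
proof -
  have "(\<forall>i. P i) \<longleftrightarrow> P 0 \<and> (\<forall>i. P (Suc i))" for P :: "nat \<Rightarrow> bool"
    by (metis nat.exhaust)
  from this [of "\<lambda>i. d + 2 * i < s \<longrightarrow> \<not> (d + 2 * i) dvd n"] show ?thesis
    unfolding no_divisor_def by (simp add: dvd_eq_mod_eq_0 add.assoc)
qed

text \<open>Restricted to literals, the rule fires again only once \<open>d + 2\<close> has been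
  evaluated.\<close>

lemmas no_divisor_numeral = no_divisor_step [of _ "numeral d" "numeral s" for d s]

text \<open>Both factors of a nontrivial factorization of the odd \<open>n\<close> are odd and
  differ from 1, hence are at least \<open>s\<close>, making \<open>n\<close> at least s^2.\<close>

lemma prime_nat_trial_division:
  fixes n s :: nat
  assumes "2 \<le> n" "n < s\<^sup>2" "odd n" "no_divisor n 3 s"
  shows "prime n"
proof (rule ccontr)
  assume "\<not> prime n"
  then obtain k where k: "k dvd n" "k \<noteq> 1" "k \<noteq> n" using assms(1) by (auto simp: prime_nat_iff)
  then obtain l where l: "n = k * l" by blast
  have *: "s \<le> d" if d: "d dvd n" "d \<noteq> 1" for d
  proof -
    have "odd d" using d assms(3) dvd_trans by blast
    then obtain j where j: "d = 2 * j + 1" by (elim oddE)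
    then have "d = 3 + 2 * (j - 1)" using d(2) by simp
    then show ?thesis using d(1) assms(4) unfolding no_divisor_def by (metis not_le)
  qed
  have "s * s \<le> k * l" using * [of k] * [of l] k l assms(1) by (intro mult_mono) auto
  then show False using assms(2) l by (simp add: power2_eq_square)
qed

text \<open>The pair $(a, b)$ following $l$ serves all $p \in [l, a)$.\<close>
fun prime_pair_chain :: "nat \<Rightarrow> (nat \<times> nat) list \<Rightarrow> nat \<Rightarrow> bool" where
  "prime_pair_chain l [] u \<longleftrightarrow> u \<le> l"
| "prime_pair_chain l ((a, b) # xs) u \<longleftrightarrow>
     prime a \<and> prime b \<and> a < b \<and> b ^ 3 < 2 * l ^ 3 \<and> prime_pair_chain a xs u"

text \<open>Each pair is tested only at the left end \<open>l\<close> of its interval, the worst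
  case for the cubic bound.\<close>

lemma prime_pair_chainD:
  assumes "prime_pair_chain l xs u" "l \<le> p" "p < u"
  shows "\<exists>a b. prime a \<and> prime b \<and> p < a \<and> a < b \<and> b ^ 3 < 2 * p ^ 3"
  using assms
proof (induction l xs u rule: prime_pair_chain.induct)
  case (2 l a b xs u)
  show ?case
  proof (cases "p < a")
    case True
    have "l ^ 3 \<le> p ^ 3" using "2.prems" by (intro power_mono) auto
    moreover have "b ^ 3 < 2 * l ^ 3" using "2.prems" by simp
    ultimately have "b ^ 3 < 2 * p ^ 3" by linarith
    then show ?thesis using "2.prems" True by auto
  qed (use 2 in auto)
qed simp

text \<open>The primes are grouped by size, so that one trial bound, with square above the largest
  member, serves a whole group.\<close>

lemma prime_chain_elems_1:
  "prime (41::nat)" "prime (43::nat)" "prime (47::nat)" "prime (53::nat)"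
  "prime (59::nat)" "prime (61::nat)" "prime (71::nat)" "prime (73::nat)"
  by (rule prime_nat_trial_division [of _ 9]; simp add: no_divisor_numeral)+

lemma prime_chain_elems_2:
  "prime (83::nat)" "prime (89::nat)" "prime (101::nat)" "prime (103::nat)"
  "prime (113::nat)" "prime (127::nat)" "prime (137::nat)" "prime (139::nat)"
  by (rule prime_nat_trial_division [of _ 12]; simp add: no_divisor_numeral)+

lemma prime_chain_elems_3:
  "prime (163::nat)" "prime (167::nat)" "prime (197::nat)" "prime (199::nat)"
  "prime (239::nat)" "prime (241::nat)" "prime (283::nat)" "prime (293::nat)"
  by (rule prime_nat_trial_division [of _ 18]; simp add: no_divisor_numeral)+

lemma prime_chain_elems_4:
  "prime (349::nat)" "prime (353::nat)" "prime (433::nat)" "prime (439::nat)"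
  "prime (523::nat)" "prime (541::nat)" "prime (647::nat)" "prime (653::nat)"
  by (rule prime_nat_trial_division [of _ 26]; simp add: no_divisor_numeral)+

lemma prime_chain_elems_5:
  "prime (809::nat)" "prime (811::nat)" "prime (1013::nat)" "prime (1019::nat)"
  "prime (1249::nat)" "prime (1259::nat)" "prime (1567::nat)" "prime (1571::nat)"
  by (rule prime_nat_trial_division [of _ 40]; simp add: no_divisor_numeral)+

lemma prime_chain_elems_6:
  "prime (1951::nat)" "prime (1973::nat)" "prime (2441::nat)" "prime (2447::nat)"
  "prime (3061::nat)" "prime (3067::nat)" "prime (3851::nat)" "prime (3853::nat)"
  by (rule prime_nat_trial_division [of _ 63]; simp add: no_divisor_numeral)+

lemma prime_chain_elems_7:
  "prime (4817::nat)" "prime (4831::nat)" "prime (6053::nat)" "prime (6067::nat)"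
  "prime (7607::nat)" "prime (7621::nat)" "prime (9547::nat)" "prime (9551::nat)"
  by (rule prime_nat_trial_division [of _ 98]; simp add: no_divisor_numeral)+

lemma prime_chain_elems_8:
  "prime (12007::nat)" "prime (12011::nat)" "prime (15107::nat)" "prime (15121::nat)"
  "prime (19013::nat)" "prime (19031::nat)" "prime (23917::nat)" "prime (23929::nat)"
  by (rule prime_nat_trial_division [of _ 155]; simp add: no_divisor_numeral)+

lemma prime_chain_elems_9:
  "prime (30119::nat)" "prime (30133::nat)" "prime (37897::nat)" "prime (37907::nat)"
  "prime (47741::nat)" "prime (47743::nat)" "prime (60139::nat)" "prime (60149::nat)"
  by (rule prime_nat_trial_division [of _ 246]; simp add: no_divisor_numeral)+

lemma prime_chain_elems_10:
  "prime (75743::nat)" "prime (75767::nat)" "prime (95419::nat)" "prime (95429::nat)"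
  "prime (120199::nat)" "prime (120209::nat)" "prime (151429::nat)" "prime (151433::nat)"
  by (rule prime_nat_trial_division [of _ 390]; simp add: no_divisor_numeral)+

text \<open>Consecutive entries may grow by a factor of nearly 2^(1/3), about 1.26, so 42 pairs
  reach 2^17.\<close>

lemma prime_pair_chain_explicit:
  "prime_pair_chain 37 [
     (41, 43), (43, 47), (47, 53), (53, 59), (59, 61), (71, 73), (83, 89), (101, 103),
     (113, 127), (137, 139), (163, 167), (197, 199), (239, 241), (283, 293), (349, 353),
     (433, 439), (523, 541), (647, 653), (809, 811), (1013, 1019), (1249, 1259), (1567, 1571),
     (1951, 1973), (2441, 2447), (3061, 3067), (3851, 3853), (4817, 4831), (6053, 6067),
     (7607, 7621), (9547, 9551), (12007, 12011), (15107, 15121), (19013, 19031),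
     (23917, 23929), (30119, 30133), (37897, 37907), (47741, 47743), (60139, 60149),
     (75743, 75767), (95419, 95429), (120199, 120209), (151429, 151433)] (2 ^ 17)"
  \<comment> \<open>Deleting \<open>prime_nat_numeral_eq\<close> makes the simplifier use the
    recorded primes instead of testing them anew.\<close>
  by (simp add: prime_chain_elems_1 prime_chain_elems_2 prime_chain_elems_3
      prime_chain_elems_4 prime_chain_elems_5 prime_chain_elems_6
      prime_chain_elems_7 prime_chain_elems_8 prime_chain_elems_9
      prime_chain_elems_10 del: prime_nat_numeral_eq)

text \<open>The bound is stronger than the goal, with \<open>p\<close> in place of the next prime.
  It fails at 31, where the second prime after is 41 and 41^3 = 68921 > 59582 = 2 * 31^3.\<close>

lemma ex_two_primes:
  fixes p :: nat
  assumes "37 \<le> p"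
  shows "\<exists>a b. prime a \<and> prime b \<and> p < a \<and> a < b \<and> b ^ 3 < 2 * p ^ 3"
proof (cases "p < 2 ^ 17")
  case True
  then show ?thesis using prime_pair_chainD [OF prime_pair_chain_explicit assms] by simp
next
  case False
  define S where "S = {q \<in> {p<..5 * p div 4}. prime q}"
  have "\<not> card S \<le> Suc 0" using False card_primes_ge_2 [of p] by (simp add: S_def)
  moreover have "finite S" by (simp add: S_def)
  ultimately obtain a b where ab: "a \<in> S" "b \<in> S" "a < b"
    by (metis card_le_Suc0_iff_eq linorder_neq_iff)
  then have "4 * b \<le> 5 * p" by (auto simp: S_def)
  then have "(4 * b) ^ 3 \<le> (5 * p) ^ 3" by (intro power_mono) auto
  then have "64 * b ^ 3 \<le> 125 * p ^ 3" by (simp add: power_mult_distrib)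
  moreover have "0 < p ^ 3" using assms by simp
  ultimately have "b ^ 3 < 2 * p ^ 3" by linarith
  then show ?thesis using ab by (auto simp: S_def)
qed

section \<open>The $n$th prime\<close>

lemma enumerate_Suc_le:
  fixes S :: "nat set"
  assumes "infinite S" "q \<in> S" "enumerate S k < q"
  shows "enumerate S (Suc k) \<le> q"
  unfolding enumerate_Suc'' [OF assms(1)] using assms by (intro Least_le) simp

lemma infinite_primes_nat: "infinite {p::nat. prime p}"
  using primes_infinite by simp

lemma prime_nth_prime: "prime (nth_prime n)"
  using enumerate_in_set [OF infinite_primes_nat] by (simp add: nth_prime_def)

text \<open>At 0 this fails: truncated subtraction gives indices 0 and 1 the same value.\<close>

lemma nth_prime_less_Suc: "1 \<le> n \<Longrightarrow> nth_prime n < nth_prime (Suc n)"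
  using enumerate_step [OF infinite_primes_nat, of "n - 1"] by (simp add: nth_prime_def)

lemma nth_prime_Suc_le:
  assumes "1 \<le> n" "prime q" "nth_prime n < q"
  shows "nth_prime (Suc n) \<le> q"
  using enumerate_Suc_le [OF infinite_primes_nat, of q "n - 1"] assms by (simp add: nth_prime_def)

lemma nth_prime_add_2_le:
  assumes "1 \<le> n" "nth_prime n < a" "a < b" "prime a" "prime b"
  shows "nth_prime (n + 2) \<le> b"
  using nth_prime_Suc_le [OF assms(1,4,2)] nth_prime_Suc_le [of "Suc n" b] assms by simp

text \<open>The gap is given as a list, so that \<open>upt_rec\<close> unfolds it into finitely many
  compositeness checks.\<close>

lemma prime_ge_next:
  fixes p q :: nat
  assumes "prime p" "m < p" "\<And>k. k \<in> set [Suc m..<q] \<Longrightarrow> \<not> prime k"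
  shows "q \<le> p"
  using assms by (metis Suc_leI atLeastLessThan_iff not_le set_upt)

text \<open>Lower bounds suffice, so \<open>enumerate\<close> is never evaluated: strict growth and
  the composite gaps lift the bound from each prime to the next.\<close>

lemma nth_prime_ge_23:
  assumes "9 \<le> n"
  shows "23 \<le> nth_prime n"
  using assms
proof (induction n rule: dec_induct)
  case base
  note P = prime_ge_next [OF prime_nth_prime]
  have step: "m < nth_prime (Suc k)" if "m \<le> nth_prime k" "1 \<le> k" for m k
    using nth_prime_less_Suc [OF that(2)] that(1) by simp
  have "2 \<le> nth_prime 1" using prime_ge_2_nat [OF prime_nth_prime] .
  then have "3 \<le> nth_prime 2" using step [of 2 1] by (simp add: numeral_eq_Suc)
  then have "5 \<le> nth_prime 3" using step [of 3 2] by (intro P [of 3]) (auto simp: upt_rec)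
  then have "7 \<le> nth_prime 4" using step [of 5 3] by (intro P [of 5]) (auto simp: upt_rec)
  then have "11 \<le> nth_prime 5" using step [of 7 4] by (intro P [of 7]) (auto simp: upt_rec)
  then have "13 \<le> nth_prime 6" using step [of 11 5] by (intro P [of 11]) (auto simp: upt_rec)
  then have "17 \<le> nth_prime 7" using step [of 13 6] by (intro P [of 13]) (auto simp: upt_rec)
  then have "19 \<le> nth_prime 8" using step [of 17 7] by (intro P [of 17]) (auto simp: upt_rec)
  then show ?case using step [of 19 8] by (intro P [of 19]) (auto simp: upt_rec)
next
  case (step k)
  then show ?case using nth_prime_less_Suc [of k] by simp
qed

theorem theorem3:
  fixes n :: nat
  assumes "n \<ge> 9"
  shows "nth_prime (n + 2) ^ 3 < nth_prime (n + 1) ^ 3 + nth_prime n ^ 3"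
proof -
  define p q r where "p = nth_prime n" and "q = nth_prime (n + 1)" and "r = nth_prime (n + 2)"
  have p: "prime p" "23 \<le> p" and q: "prime q" "p < q"
    using assms nth_prime_ge_23 prime_nth_prime nth_prime_less_Suc [of n]
    by (auto simp: p_def q_def)
  have r_le: "r \<le> b" if "p < a" "a < b" "prime a" "prime b" for a b
    using nth_prime_add_2_le [of n a b] assms that by (simp add: p_def r_def)
  \<comment> \<open>Only an upper bound for \<open>r\<close> and a lower bound for \<open>q\<close>
    are required: m = p when p >= 37, and the actual next prime for 23, 29 and 31, where 2 p^3 is
    too small.\<close>
  have less: ?thesis if "b ^ 3 < m ^ 3 + p ^ 3" "r \<le> b" "m \<le> q" for b m
  proof -
    have "r ^ 3 \<le> b ^ 3" "m ^ 3 \<le> q ^ 3" using that by (auto intro: power_mono)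
    then show ?thesis using that(1) unfolding p_def [symmetric] q_def [symmetric] r_def [symmetric]
      by linarith
  qed
  consider "37 \<le> p" | "p = 23" | "p = 29" | "p = 31"
  proof -
    have "29 \<le> p" if "p \<noteq> 23"
      using that p by (intro prime_ge_next [of p 23]) (auto simp: upt_rec)
    moreover have "31 \<le> p" if "29 < p"
      using that p by (intro prime_ge_next [of p 29]) (auto simp: upt_rec)
    moreover have "37 \<le> p" if "31 < p"
      using that p by (intro prime_ge_next [of p 31]) (auto simp: upt_rec)
    ultimately show ?thesis using that by linarith
  qed
  then show ?thesis
  proof cases
    case 1
    then obtain a b where ab: "prime a" "prime b" "p < a" "a < b" "b ^ 3 < 2 * p ^ 3"
      using ex_two_primes by blast
    then show ?thesis using less [of b p] r_le [of a b] q by simp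
  next
    case 2
    then have "29 \<le> q" using q by (intro prime_ge_next [of q 23]) (auto simp: upt_rec)
    then show ?thesis using less [of 31 29] r_le [of 29 31] 2 by simp
  next
    case 3
    then have "31 \<le> q" using q by (intro prime_ge_next [of q 29]) (auto simp: upt_rec)
    then show ?thesis using less [of 37 31] r_le [of 31 37] 3 by simp
  next
    case 4
    then have "37 \<le> q" using q by (intro prime_ge_next [of q 31]) (auto simp: upt_rec)
    then show ?thesis using less [of 41 37] r_le [of 37 41] 4 by simp
  qed
qed

end
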